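(* Let $R$ be a reduced unitary ring. Then $R$, with the reduced ring order $\le_{\mathrm{rr}}$, is an upper semi-lattice (every pair of elements has a supremum) if and only if $R$ is a Boolean ring (i.e. $a^2=a$ for all $a\in R$).
   Context: A ring is reduced if it has no non-zero nilpotent elements. The reduced ring order (rr-order) on a reduced ring $R$ is the partial order $a\le_{\mathrm{rr}} b$ if and only if $ab=a^2$. *)

theory Defs
  imports "HOL-Algebra.Algebra"
begin

text \<open>
  Rings are those of \<^locale>\<open>ring\<close>: associative and unital, but not necessarily commutative;
  the zero ring is allowed.
\<close>

definition nilpotent_in :: "('a, 'm) ring_scheme \<Rightarrow> 'a \<Rightarrow> bool" where
  "nilpotent_in R a \<longleftrightarrow> (\<exists>n::nat. n > 0 \<and> a [^]\<^bsub>R\<^esub> n = \<zero>\<^bsub>R\<^esub>)"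

locale reduced_ring = ring R for R (structure) +
  assumes reduced: "\<lbrakk>a \<in> carrier R; nilpotent_in R a\<rbrakk> \<Longrightarrow> a = \<zero>"

locale boolean_ring = ring R for R (structure) +
  assumes idempotent: "a \<in> carrier R \<Longrightarrow> a [^] (2::nat) = a"

definition rr_le :: "('a, 'm) ring_scheme \<Rightarrow> 'a \<Rightarrow> 'a \<Rightarrow> bool" where
  "rr_le R a b \<longleftrightarrow> a \<otimes>\<^bsub>R\<^esub> b = a [^]\<^bsub>R\<^esub> (2::nat)"

text \<open>
  The ring with its reduced ring order, as an ordered structure in the sense of
  \<^theory>\<open>HOL-Algebra.Order\<close>; the underlying equivalence is plain equality.
\<close>

definition rr_order :: "('a, 'm) ring_scheme \<Rightarrow> 'a gorder" where
  "rr_order R = \<lparr>carrier = carrier R, eq = (=), le = rr_le R\<rparr>"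

context reduced_ring
begin

lemma square_zero:
  assumes "a \<in> carrier R" "a \<otimes> a = \<zero>"
  shows "a = \<zero>"
proof (rule reduced[OF assms(1)])
  have "a [^] (2::nat) = \<zero>"
    using assms by (simp add: numeral_2_eq_2)
  then show "nilpotent_in R a"
    unfolding nilpotent_in_def by (intro exI[of _ 2]) simp
qed

lemma mult_zero_commute:
  assumes "a \<in> carrier R" "b \<in> carrier R" "a \<otimes> b = \<zero>"
  shows "b \<otimes> a = \<zero>"
proof (rule square_zero)
  have "b \<otimes> a \<otimes> (b \<otimes> a) = b \<otimes> (a \<otimes> b) \<otimes> a"
    using assms(1,2) by (simp add: m_assoc)
  then show "b \<otimes> a \<otimes> (b \<otimes> a) = \<zero>"
    using assms by simp
qed (use assms in simp)

lemma minus_l_distr: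
  assumes "a \<in> carrier R" "b \<in> carrier R" "c \<in> carrier R"
  shows "(a \<ominus> b) \<otimes> c = a \<otimes> c \<ominus> b \<otimes> c"
  using assms by (simp add: a_minus_def l_distr l_minus)

lemma minus_r_distr:
  assumes "a \<in> carrier R" "b \<in> carrier R" "c \<in> carrier R"
  shows "c \<otimes> (a \<ominus> b) = c \<otimes> a \<ominus> c \<otimes> b"
  using assms by (simp add: a_minus_def r_distr r_minus)

lemma rr_le_iff:
  assumes "a \<in> carrier R" "b \<in> carrier R"
  shows "rr_le R a b \<longleftrightarrow> a \<otimes> (b \<ominus> a) = \<zero>"
proof -
  have "a \<otimes> (b \<ominus> a) = a \<otimes> b \<ominus> a \<otimes> a"
    using assms by (simp add: minus_r_distr)
  moreover have "a [^] (2::nat) = a \<otimes> a"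
    using assms by (simp add: numeral_2_eq_2)
  ultimately show ?thesis
    using assms by (simp add: rr_le_def)
qed

theorem rr_order_partial_order: "partial_order (rr_order R)"
proof -
  have sq: "x [^] (2::nat) = x \<otimes> x" if "x \<in> carrier R" for x
    using that by (simp add: numeral_2_eq_2)
  have antisym: "x = y"
    if "rr_le R x y" "rr_le R y x" and xy: "x \<in> carrier R" "y \<in> carrier R" for x y
  proof -
    have eqs: "x \<otimes> y = x \<otimes> x" "y \<otimes> x = y \<otimes> y"
      using that sq by (auto simp: rr_le_def)
    have "(y \<ominus> x) \<otimes> (y \<ominus> x) = y \<otimes> (y \<ominus> x) \<ominus> x \<otimes> (y \<ominus> x)"
      using xy by (simp add: minus_l_distr)
    also have "\<dots> = \<zero>"
      using xy eqs by (simp add: minus_r_distr) (simp add: a_minus_def r_neg)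
    finally have "y \<ominus> x = \<zero>"
      by (rule square_zero[rotated]) (use xy in simp)
    then show ?thesis
      using xy by simp
  qed
  have trans: "rr_le R x z"
    if le: "rr_le R x y" "rr_le R y z"
      and c: "x \<in> carrier R" "y \<in> carrier R" "z \<in> carrier R" for x y z
  proof -
    define d where "d = z \<ominus> y"
    have d: "d \<in> carrier R"
      using c by (simp add: d_def)
    have "x \<otimes> (y \<ominus> x) = \<zero>"
      using le c rr_le_iff by blast
    then have "(y \<ominus> x) \<otimes> x = \<zero>"
      by (rule mult_zero_commute[rotated 2]) (use c in simp_all)
    then have "y \<otimes> x = x \<otimes> x"
      using c by (simp add: minus_l_distr)
    moreover have "y \<otimes> (x \<otimes> d) = \<zero>"
    proof (rule mult_zero_commute)
      have "y \<otimes> d = \<zero>"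
        using le c rr_le_iff unfolding d_def by blast
      then have "d \<otimes> y = \<zero>"
        by (rule mult_zero_commute[rotated 2]) (use c d in simp_all)
      then show "x \<otimes> d \<otimes> y = \<zero>"
        using c d by (simp add: m_assoc)
    qed (use c d in simp_all)
    ultimately have "x \<otimes> (x \<otimes> d) = \<zero>"
      using c d by (metis m_assoc)
    then have "(x \<otimes> d) \<otimes> x = \<zero>"
      by (rule mult_zero_commute[rotated 2]) (use c d in simp_all)
    then have "(x \<otimes> d) \<otimes> (x \<otimes> d) = \<zero>"
      using c d by (metis m_assoc m_closed l_null)
    then have "x \<otimes> d = \<zero>"
      by (rule square_zero[rotated]) (use c d in simp)
    then have "x \<otimes> z = x \<otimes> y"
      using c by (simp add: d_def minus_r_distr)
    then show ?thesis
      using le by (simp add: rr_le_def)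
  qed
  show ?thesis
    by unfold_locales
      (simp_all add: rr_order_def rr_le_def[of R x x for x] sq, (blast intro: antisym trans)+)
qed

end

end

theory Submission
  imports Defs
begin

text \<open>
  The element \<open>\<one>\<close> is maximal in the reduced ring order, since \<open>\<one> \<le> b\<close> says \<open>b = \<one>\<close>. Hence the
  supremum of \<open>a\<close> and \<open>\<one>\<close> can only be \<open>\<one>\<close>, and \<open>a \<le> \<one>\<close> says that \<open>a\<close> is idempotent. Conversely,
  in a Boolean ring the supremum of \<open>a\<close> and \<open>b\<close> is \<open>a + b + ab\<close>.
\<close>

context ring
begin

lemma one_rr_le_iff:
  assumes "b \<in> carrier R"
  shows "rr_le R \<one> b \<longleftrightarrow> b = \<one>"
  using assms by (simp add: rr_le_def)

lemma rr_le_one_iff: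
  assumes "a \<in> carrier R"
  shows "rr_le R a \<one> \<longleftrightarrow> a [^] (2::nat) = a"
  using assms by (auto simp: rr_le_def)

end

context boolean_ring
begin

lemma mult_self:
  assumes "a \<in> carrier R"
  shows "a \<otimes> a = a"
  using idempotent[OF assms] assms by (simp add: numeral_2_eq_2)

text \<open>Expanding the square of \<open>a \<oplus> a\<close> gives four copies of
  \<open>a\<close>, while idempotence of \<open>a \<oplus> a\<close> leaves two; cancel.\<close>

lemma add_self:
  assumes a: "a \<in> carrier R"
  shows "a \<oplus> a = \<zero>"
proof -
  have "(a \<oplus> a) \<oplus> (a \<oplus> a) = (a \<oplus> a) \<otimes> (a \<oplus> a)"
    using a by (simp add: l_distr r_distr mult_self[OF a])
  also have "\<dots> = a \<oplus> a"
    using a by (simp add: mult_self)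
  finally show ?thesis
    using a by simp
qed

text \<open>Idempotence of \<open>a \<oplus> b\<close> forces the cross terms of its square to sum
  to zero; in characteristic two this means that they are equal.\<close>

lemma mult_commute:
  assumes a: "a \<in> carrier R" and b: "b \<in> carrier R"
  shows "a \<otimes> b = b \<otimes> a"
proof -
  have "(a \<oplus> b) \<oplus> (a \<otimes> b \<oplus> b \<otimes> a) = (a \<oplus> b) \<otimes> (a \<oplus> b)"
    using a b by (simp add: l_distr r_distr mult_self[OF a] mult_self[OF b] a_ac)
  also have "\<dots> = a \<oplus> b"
    using a b by (simp add: mult_self)
  finally have "a \<otimes> b \<oplus> b \<otimes> a = \<zero>"
    using a b by simp
  then have "a \<otimes> b \<oplus> b \<otimes> a = b \<otimes> a \<oplus> b \<otimes> a"
    using a b by (simp add: add_self)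
  then show ?thesis
    using a b by simp
qed

lemma rr_le_iff_mult_eq:
  assumes "a \<in> carrier R"
  shows "rr_le R a b \<longleftrightarrow> a \<otimes> b = a"
  using assms by (simp add: rr_le_def idempotent)

text \<open>Removes the product term that occurs twice when \<open>a\<close> or \<open>b\<close> is
  multiplied by the join.\<close>

lemma add_add_self:
  assumes "a \<in> carrier R" "b \<in> carrier R"
  shows "(a \<oplus> b) \<oplus> b = a"
  using assms by (simp add: a_assoc add_self)

lemma least_rr_order_join:
  assumes a: "a \<in> carrier R" and b: "b \<in> carrier R"
  shows "least (rr_order R) (a \<oplus> b \<oplus> a \<otimes> b) (Upper (rr_order R) {a, b})"
proof -
  have "a \<otimes> (a \<oplus> b \<oplus> a \<otimes> b) = a \<oplus> a \<otimes> b \<oplus> a \<otimes> b"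
    using a b by (simp add: r_distr mult_self flip: m_assoc)
  then have le_a: "rr_le R a (a \<oplus> b \<oplus> a \<otimes> b)"
    using a b by (simp add: rr_le_iff_mult_eq add_add_self)
  \<comment> \<open>Commuting \<open>a \<otimes> b\<close> to \<open>b \<otimes> a\<close> brings
    the two factors \<open>b\<close> together, so that idempotence merges them.\<close>
  have "b \<otimes> (a \<oplus> b \<oplus> a \<otimes> b) = b \<oplus> b \<otimes> a \<oplus> b \<otimes> a"
    using a b by (simp add: r_distr mult_self mult_commute[OF a b] a_ac flip: m_assoc)
  then have le_b: "rr_le R b (a \<oplus> b \<oplus> a \<otimes> b)"
    using a b by (simp add: rr_le_iff_mult_eq add_add_self)
  \<comment> \<open>Right multiplication by \<open>c\<close> fixes \<open>a\<close> and
    \<open>b\<close>, hence also \<open>a \<otimes> b\<close> and the whole sum.\<close>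
  have "rr_le R (a \<oplus> b \<oplus> a \<otimes> b) c"
    if "c \<in> carrier R" "rr_le R a c" "rr_le R b c" for c
    using that a b by (simp add: rr_le_iff_mult_eq l_distr m_assoc)
  with le_a le_b a b show ?thesis
    by (auto simp: least_def Upper_def rr_order_def)
qed

end

theorem proposition2p8:
  fixes R :: "('a, 'm) ring_scheme" (structure)
  assumes "reduced_ring R"
  shows "upper_semilattice (rr_order R) \<longleftrightarrow> boolean_ring R"
proof
  interpret reduced_ring R by (fact assms)
  assume "upper_semilattice (rr_order R)"
  then interpret L: upper_semilattice "rr_order R" .
  show "boolean_ring R"
  proof unfold_locales
    fix a assume a: "a \<in> carrier R"
    then obtain s where "least (rr_order R) s (Upper (rr_order R) {a, \<one>})"
      using L.sup_of_two_exists[of a \<one>] by (auto simp: rr_order_def)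
    then have s: "s \<in> carrier R" "rr_le R a s" "rr_le R \<one> s"
      using a by (auto simp: least_def Upper_def rr_order_def)
    then show "a [^] (2::nat) = a"
      using a by (simp add: one_rr_le_iff rr_le_one_iff)
  qed
next
  \<comment> \<open>Reducedness supplies the order axioms, so only the suprema of pairs remain to be
    found.\<close>
  interpret P: partial_order "rr_order R"
    by (rule reduced_ring.rr_order_partial_order[OF assms])
  assume "boolean_ring R"
  then interpret boolean_ring R .
  show "upper_semilattice (rr_order R)"
    by unfold_locales (use least_rr_order_join in \<open>auto simp: rr_order_def\<close>)
qed

end
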